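(* Let $A$ be a finite two-sided brace. Then $A$ is Baer radical if and only if $A$ is solvable.
   Context: A skew brace is a triple $(A,+,\circ)$ where $(A,+)$ and $(A,\circ)$ are (not necessarily abelian) groups with $a\circ(b+c)=a\circ b-a+a\circ c$ for all $a,b,c\in A$ (the two groups share the identity element $0$). A brace is a skew brace with abelian additive group; it is two-sided if moreover $(a+b)\circ c=a\circ c-c+b\circ c$ for all $a,b,c$. For $a,b\in A$ put $\lambda_a(b)=-a+a\circ b$ and $a*b=\lambda_a(b)-b$. For subsets $X,Y\subseteq A$, $X*Y$ denotes the subgroup of $(A,+)$ generated by $\{x*y:x\in X,\ y\in Y\}$. An ideal of $A$ is a normal subgroup $I$ of $(A,\circ)$ such that $\lambda_a(I)\subseteq I$ and $a+I=I+a$ for all $a\in A$. For $a\in A$, $\langle a\rangle$ denotes the smallest ideal of $A$ containing $a$. An $n$-sequence in $A$ is a sequence $a_1,a_2,\ldots$ of elements of $A$ with $a_{i+1}\in\langle a_i\rangle*\langle a_i\rangle$ for all $i\ge 1$. $A$ is Baer radical if every $n$-sequence in $A$ reaches zero at some point. Put $A_1=A$ and $A_{i+1}=A_i*A_i$ for $i\ge1$. $A$ is solvable if $A_n=0$ for some $n$. *)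

theory Defs
  imports "HOL-Algebra.Generated_Groups" "HOL-Algebra.AbelCoset"
begin

text \<open>
  A skew brace is carried by a ring record: \<open>\<oplus>\<close>, \<open>\<zero>\<close>, \<open>\<ominus>\<close> belong to the additive group
  (not assumed abelian), and \<open>\<otimes>\<close>, \<open>\<one>\<close> to the group written with a circle in the literature.
  The record is used only as a signature: \<open>\<otimes>\<close> is not assumed to distribute over \<open>\<oplus>\<close>.
  That \<open>\<one> = \<zero>\<close> is a consequence of the axioms (take b = c = \<open>\<zero>\<close> in compatibility).
\<close>

locale skew_brace = circ?: group A + plus?: group "add_monoid A" for A (structure) +
  assumes left_compat:
    "\<lbrakk>a \<in> carrier A; b \<in> carrier A; c \<in> carrier A\<rbrakk>
      \<Longrightarrow> a \<otimes> (b \<oplus> c) = ((a \<otimes> b) \<ominus> a) \<oplus> (a \<otimes> c)"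

locale brace = skew_brace A + plus?: comm_group "add_monoid A" for A (structure)

locale two_sided_brace = brace A for A (structure) +
  assumes right_compat:
    "\<lbrakk>a \<in> carrier A; b \<in> carrier A; c \<in> carrier A\<rbrakk>
      \<Longrightarrow> (a \<oplus> b) \<otimes> c = ((a \<otimes> c) \<ominus> c) \<oplus> (b \<otimes> c)"

definition brace_lambda :: "('a, 'm) ring_scheme \<Rightarrow> 'a \<Rightarrow> 'a \<Rightarrow> 'a" where
  "brace_lambda A a b = (\<ominus>\<^bsub>A\<^esub> a) \<oplus>\<^bsub>A\<^esub> (a \<otimes>\<^bsub>A\<^esub> b)"

definition brace_star :: "('a, 'm) ring_scheme \<Rightarrow> 'a \<Rightarrow> 'a \<Rightarrow> 'a" where
  "brace_star A a b = brace_lambda A a b \<ominus>\<^bsub>A\<^esub> b"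

definition brace_star_set :: "('a, 'm) ring_scheme \<Rightarrow> 'a set \<Rightarrow> 'a set \<Rightarrow> 'a set" where
  "brace_star_set A X Y = generate (add_monoid A) {brace_star A x y | x y. x \<in> X \<and> y \<in> Y}"

text \<open>Normality \<open>\<lhd>\<close> refers to the multiplicative part of the record, i.e. to the circle group.\<close>

definition brace_ideal :: "'a set \<Rightarrow> ('a, 'm) ring_scheme \<Rightarrow> bool" where
  "brace_ideal I A \<longleftrightarrow>
     I \<lhd> A \<and>
     (\<forall>a\<in>carrier A. brace_lambda A a ` I \<subseteq> I \<and> a <+\<^bsub>A\<^esub> I = I +>\<^bsub>A\<^esub> a)"

definition brace_genideal :: "('a, 'm) ring_scheme \<Rightarrow> 'a \<Rightarrow> 'a set" where
  "brace_genideal A a = \<Inter>{I. brace_ideal I A \<and> a \<in> I}"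

text \<open>Sequences are indexed from 0 instead of 1.\<close>

definition n_sequence :: "('a, 'm) ring_scheme \<Rightarrow> (nat \<Rightarrow> 'a) \<Rightarrow> bool" where
  "n_sequence A a \<longleftrightarrow>
     (\<forall>i. a i \<in> carrier A) \<and>
     (\<forall>i. a (Suc i) \<in> brace_star_set A (brace_genideal A (a i)) (brace_genideal A (a i)))"

definition baer_radical :: "('a, 'm) ring_scheme \<Rightarrow> bool" where
  "baer_radical A \<longleftrightarrow> (\<forall>a. n_sequence A a \<longrightarrow> (\<exists>i. a i = \<zero>\<^bsub>A\<^esub>))"

text \<open>\<open>brace_derived A i\<close> is the term usually written with index i + 1, the 0th one being A itself.\<close>

primrec brace_derived :: "('a, 'm) ring_scheme \<Rightarrow> nat \<Rightarrow> 'a set" where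
  "brace_derived A 0 = carrier A"
| "brace_derived A (Suc i) = brace_star_set A (brace_derived A i) (brace_derived A i)"

definition brace_solvable :: "('a, 'm) ring_scheme \<Rightarrow> bool" where
  "brace_solvable A \<longleftrightarrow> (\<exists>n. brace_derived A n = {\<zero>\<^bsub>A\<^esub>})"

end

theory Submission
  imports Defs
begin

text \<open>
  A two-sided brace is a Jacobson radical ring under \<open>+\<close> and \<open>*\<close>: both distributive laws and
  associativity hold, and \<open>x \<mapsto> x + x * v\<close> has an inverse of the same form because \<open>v\<close> is
  invertible for the circle operation. By Nakayama's lemma a nonzero finite right ideal \<open>B\<close>
  satisfies \<open>B * A \<noteq> B\<close>, so in the finite case the derived series, which consists of ideals,
  strictly decreases to 0. Hence a finite two-sided brace is always solvable. It is also always
  Baer radical, since the ith term of an n-sequence lies in the ith derived ideal.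
\<close>

sublocale two_sided_brace \<subseteq> abelian_group A
  by (intro abelian_group.intro abelian_monoid.intro abelian_group_axioms.intro
      plus.comm_monoid_axioms plus.comm_group_axioms)

context two_sided_brace
begin

text \<open>
  The instance \<open>plus\<close> of \<^locale>\<open>group\<close> subsumes the one through which these rules reach the
  simplifier in \<^locale>\<open>abelian_group\<close>.
\<close>

declare a_closed [simp, intro] zero_closed [simp, intro] a_inv_closed [simp, intro]
  l_zero [simp] r_zero [simp] minus_minus [simp]

section \<open>The radical ring with product \<open>\<star>\<close>\<close>

abbreviation star (infixl "\<star>" 70) where "x \<star> y \<equiv> brace_star A x y"

lemma a_l_cancel:
  "x \<in> carrier A \<Longrightarrow> y \<in> carrier A \<Longrightarrow> z \<in> carrier A \<Longrightarrow> x \<oplus> y = x \<oplus> z \<longleftrightarrow> y = z"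
  using r_neg2[of x y] r_neg2[of x z] r_neg1[of x y] r_neg1[of x z] by metis

lemma star_closed [simp, intro]:
  "x \<in> carrier A \<Longrightarrow> y \<in> carrier A \<Longrightarrow> x \<star> y \<in> carrier A"
  by (simp add: brace_star_def brace_lambda_def)

text \<open>Presents the circle as the adjoint operation of a ring, so that circle identities become
  identities in \<open>\<oplus>\<close> and \<open>\<star>\<close>.\<close>

lemma circ_eq:
  assumes "x \<in> carrier A" "y \<in> carrier A"
  shows "x \<otimes> y = x \<oplus> y \<oplus> x \<star> y"
  using assms by (simp add: brace_star_def brace_lambda_def minus_eq a_ac r_neg1 r_neg2)

lemma lambda_eq:
  assumes "x \<in> carrier A" "y \<in> carrier A"
  shows "brace_lambda A x y = x \<star> y \<oplus> y"
  using assms by (simp add: brace_star_def brace_lambda_def minus_eq a_assoc l_neg)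

lemma one_eq_zero: "\<one> = \<zero>"
proof -
  have "\<ominus> \<one> = \<zero>"
    using left_compat[of \<one> \<zero> \<zero>] by (simp add: minus_eq)
  then show ?thesis
    using r_neg[of \<one>] by simp
qed

lemma star_distrib_left:
  assumes "x \<in> carrier A" "y \<in> carrier A" "z \<in> carrier A"
  shows "x \<star> (y \<oplus> z) = x \<star> y \<oplus> x \<star> z"
  using assms
  by (simp add: brace_star_def brace_lambda_def left_compat minus_eq minus_add a_ac r_neg1 r_neg2)

lemma star_distrib_right:
  assumes "x \<in> carrier A" "y \<in> carrier A" "z \<in> carrier A"
  shows "(x \<oplus> y) \<star> z = x \<star> z \<oplus> y \<star> z"
  using assms
  by (simp add: brace_star_def brace_lambda_def right_compat minus_eq minus_add a_ac r_neg1 r_neg2)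

text \<open>Both bracketings of the circle product of \<open>x\<close>, \<open>y\<close>,
  \<open>z\<close> expand by distributivity into the same six terms \<open>?s\<close> plus one
  triple product; associativity of the circle and cancellation equate the triple products.\<close>

lemma star_assoc:
  assumes "x \<in> carrier A" "y \<in> carrier A" "z \<in> carrier A"
  shows "(x \<star> y) \<star> z = x \<star> (y \<star> z)"
proof -
  let ?s = "x \<oplus> y \<oplus> z \<oplus> x \<star> y \<oplus> x \<star> z \<oplus> y \<star> z"
  have "?s \<oplus> (x \<star> y) \<star> z = (x \<otimes> y) \<otimes> z"
    using assms by (simp add: circ_eq star_distrib_right a_ac)
  also have "\<dots> = x \<otimes> (y \<otimes> z)"
    using assms by (simp add: circ.m_assoc)
  also have "\<dots> = ?s \<oplus> x \<star> (y \<star> z)"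
    using assms by (simp add: circ_eq star_distrib_left a_ac)
  finally show ?thesis
    using assms by (simp add: a_l_cancel)
qed

lemma star_zero_left [simp]: "x \<in> carrier A \<Longrightarrow> \<zero> \<star> x = \<zero>"
  using star_distrib_right[of \<zero> \<zero> x] a_l_cancel[of "\<zero> \<star> x" "\<zero> \<star> x" \<zero>] by simp

lemma star_zero_right [simp]: "x \<in> carrier A \<Longrightarrow> x \<star> \<zero> = \<zero>"
  using star_distrib_left[of x \<zero> \<zero>] a_l_cancel[of "x \<star> \<zero>" "x \<star> \<zero>" \<zero>] by simp

lemma star_minus_left:
  assumes "x \<in> carrier A" "y \<in> carrier A"
  shows "(\<ominus> x) \<star> y = \<ominus> (x \<star> y)"
  using star_distrib_right[of "\<ominus> x" x y] assms by (simp add: l_neg minus_equality)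

lemma star_minus_right:
  assumes "x \<in> carrier A" "y \<in> carrier A"
  shows "x \<star> (\<ominus> y) = \<ominus> (x \<star> y)"
  using star_distrib_left[of x "\<ominus> y" y] assms by (simp add: l_neg minus_equality)

section \<open>Right ideals and Nakayama's lemma\<close>

text \<open>Ideals are taken in the ring with product \<open>\<star>\<close>. The multiplication of
  the record is the circle, so a ring ideal predicate on \<open>A\<close> would refer to the wrong
  product.\<close>

definition right_ideal where
  "right_ideal B \<longleftrightarrow> additive_subgroup B A \<and> (\<forall>x\<in>B. \<forall>a\<in>carrier A. x \<star> a \<in> B)"

definition two_sided_ideal where
  "two_sided_ideal B \<longleftrightarrow> right_ideal B \<and> (\<forall>x\<in>B. \<forall>a\<in>carrier A. a \<star> x \<in> B)"

text \<open>This is \<open>x \<star> A + M\<close>, to be compared with a maximal \<open>M\<close>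
  in \<open>nakayama\<close>. Without a unit for \<open>\<star>\<close>, it may fail to contain
  \<open>x\<close>.\<close>

lemma right_ideal_add_image:
  assumes M: "right_ideal M" and x: "x \<in> carrier A"
  shows "right_ideal {x \<star> a \<oplus> m | a m. a \<in> carrier A \<and> m \<in> M}" (is "right_ideal ?N")
proof -
  interpret M: additive_subgroup M A
    using M by (simp add: right_ideal_def)
  have Mr: "m \<star> a \<in> M" if "m \<in> M" "a \<in> carrier A" for m a
    using M that by (simp add: right_ideal_def)
  have "subgroup ?N (add_monoid A)"
  proof (rule plus.subgroupI)
    show "?N \<subseteq> carrier (add_monoid A)"
      using x by auto
    show "?N \<noteq> {}"
      using M.zero_closed by blast
    fix u assume "u \<in> ?N"
    then obtain a m where am: "a \<in> carrier A" "m \<in> M" "u = x \<star> a \<oplus> m"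
      by blast
    have "\<ominus> u = x \<star> (\<ominus> a) \<oplus> \<ominus> m"
      using am x by (simp add: minus_add star_minus_right)
    then show "inv\<^bsub>add_monoid A\<^esub> u \<in> ?N"
      using am by (fold a_inv_def) (blast intro: M.a_inv_closed a_inv_closed)
    fix v assume "v \<in> ?N"
    then obtain b n where bn: "b \<in> carrier A" "n \<in> M" "v = x \<star> b \<oplus> n"
      by blast
    have "u \<oplus> v = x \<star> (a \<oplus> b) \<oplus> (m \<oplus> n)"
      using am bn x by (simp add: star_distrib_left a_ac)
    then show "u \<otimes>\<^bsub>add_monoid A\<^esub> v \<in> ?N"
      using am bn by auto
  qed
  moreover have "u \<star> c \<in> ?N" if u: "u \<in> ?N" and c: "c \<in> carrier A" for u c
  proof -
    obtain a m where am: "a \<in> carrier A" "m \<in> M" "u = x \<star> a \<oplus> m"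
      using u by blast
    have "u \<star> c = x \<star> (a \<star> c) \<oplus> m \<star> c"
      using am x c by (simp add: star_distrib_right star_assoc)
    then show ?thesis
      using am c Mr by blast
  qed
  ultimately show ?thesis
    unfolding right_ideal_def additive_subgroup_def by blast
qed

text \<open>In the unitisation, \<open>x = x(1 - a)(1 + v)\<close> where \<open>v\<close> is the circle inverse of \<open>-a\<close>.\<close>

lemma right_ideal_mem_of_diff:
  assumes M: "right_ideal M" and x: "x \<in> carrier A" and a: "a \<in> carrier A"
    and d: "x \<ominus> x \<star> a \<in> M"
  shows "x \<in> M"
proof -
  interpret M: additive_subgroup M A
    using M by (simp add: right_ideal_def)
  define v where "v = inv (\<ominus> a)"
  have v: "v \<in> carrier A"
    using a by (simp add: v_def)
  have "(\<ominus> a) \<oplus> v \<oplus> (\<ominus> a) \<star> v = \<zero>"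
    using a circ_eq[of "\<ominus> a" v] v by (simp add: v_def one_eq_zero)
  then have "x \<star> ((\<ominus> a) \<oplus> v \<oplus> (\<ominus> a) \<star> v) = \<zero>"
    using x by simp
  then have "x \<star> (\<ominus> a) \<oplus> x \<star> v \<oplus> (x \<star> (\<ominus> a)) \<star> v = \<zero>"
    using x a v by (simp add: star_distrib_left star_assoc)
  then have "(x \<ominus> x \<star> a) \<oplus> (x \<ominus> x \<star> a) \<star> v = x"
    using x a v by (simp add: minus_eq star_minus_right star_distrib_right a_assoc)
  moreover have "(x \<ominus> x \<star> a) \<star> v \<in> M"
    using M d v by (simp add: right_ideal_def)
  ultimately show ?thesis
    using d M.a_closed by metis
qed

lemma star_set_subset:
  assumes "additive_subgroup M A"
    and "\<And>x y. x \<in> X \<Longrightarrow> y \<in> Y \<Longrightarrow> x \<star> y \<in> M"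
  shows "brace_star_set A X Y \<subseteq> M"
  unfolding brace_star_set_def
  using assms by (intro plus.generate_subgroup_incl) (auto simp: additive_subgroup_def)

text \<open>Choose \<open>M\<close> maximal among the right ideals properly inside \<open>B\<close>.
  For \<open>x\<close> in \<open>B\<close> outside \<open>M\<close>, the right ideal
  \<open>x \<star> A + M\<close> lies between \<open>M\<close> and \<open>B\<close> and misses
  \<open>x\<close>, so it equals \<open>M\<close>. Hence all products \<open>x \<star> a\<close>
  with \<open>x\<close> in \<open>B\<close> fall into \<open>M\<close>.\<close>

lemma nakayama:
  assumes fin: "finite B" and B: "right_ideal B" "B \<noteq> {\<zero>}"
  shows "\<not> B \<subseteq> brace_star_set A B (carrier A)"
proof -
  interpret B: additive_subgroup B A
    using B by (simp add: right_ideal_def)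
  let ?S = "{M. right_ideal M \<and> M \<subset> B}"
  have "right_ideal {\<zero>}"
    using plus.triv_subgroup by (simp add: right_ideal_def additive_subgroup_def)
  moreover have "{\<zero>} \<subset> B"
    using B(2) B.zero_closed by blast
  ultimately have ne: "?S \<noteq> {}"
    by blast
  have fin_S: "finite ?S"
    by (rule finite_subset[of _ "Pow B"]) (use fin in auto)
  obtain M where "M \<in> ?S" and max: "\<forall>N\<in>?S. M \<subseteq> N \<longrightarrow> M = N"
    using finite_has_maximal[OF fin_S ne] by (elim bexE)
  then have M: "right_ideal M" "M \<subset> B"
    by simp_all
  have maxM: "N = M" if "right_ideal N" "N \<subset> B" "M \<subseteq> N" for N
    using max that by blast
  interpret M: additive_subgroup M A
    using M by (simp add: right_ideal_def)
  have "x \<star> a \<in> M" if x: "x \<in> B" and a: "a \<in> carrier A" for x a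
  proof (cases "x \<in> M")
    case True
    then show ?thesis
      using M a by (simp add: right_ideal_def)
  next
    case False
    have xA: "x \<in> carrier A"
      using x by simp
    let ?N = "{x \<star> b \<oplus> m | b m. b \<in> carrier A \<and> m \<in> M}"
    \<comment> \<open>Membership would put some \<open>x \<ominus> x \<star> b\<close> into
      \<open>M\<close>, and quasi-invertibility of \<open>b\<close> would then put \<open>x\<close>
      itself there.\<close>
    have "x \<notin> ?N"
    proof
      assume "x \<in> ?N"
      then obtain b m where bm: "b \<in> carrier A" "m \<in> M" "x = x \<star> b \<oplus> m"
        by blast
      have "(x \<star> b \<oplus> m) \<ominus> x \<star> b = m"
        using bm(1,2) xA by (simp add: minus_eq a_comm[of _ m] a_assoc r_neg)
      then have "x \<ominus> x \<star> b \<in> M"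
        using bm by metis
      then show False
        using right_ideal_mem_of_diff[OF M(1) xA bm(1)] False by blast
    qed
    moreover have "?N \<subseteq> B"
      using B x M by (auto simp: right_ideal_def)
    moreover have "M \<subseteq> ?N"
    proof
      fix m assume "m \<in> M"
      then have "m = x \<star> \<zero> \<oplus> m"
        using xA by simp
      then show "m \<in> ?N"
        using \<open>m \<in> M\<close> by blast
    qed
    ultimately have "?N = M"
      using maxM right_ideal_add_image[OF M(1) xA] x by blast
    moreover have "x \<star> a = x \<star> a \<oplus> \<zero>"
      using xA a by simp
    ultimately show ?thesis
      using a M.zero_closed by blast
  qed
  then have "brace_star_set A B (carrier A) \<subseteq> M"
    by (intro star_set_subset M.additive_subgroup_axioms) auto
  then show ?thesis
    using M by blast
qed

section \<open>Two-sided ideals and the derived series\<close>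

text \<open>By associativity an outer factor is absorbed into \<open>x\<close> or \<open>y\<close>
  of a generator \<open>x \<star> y\<close>; distributivity carries this over to the generated
  subgroup.\<close>

lemma two_sided_ideal_star_set:
  assumes I: "two_sided_ideal I" and J: "two_sided_ideal J"
  shows "two_sided_ideal (brace_star_set A I J)" (is "two_sided_ideal ?P")
proof -
  have IJ: "I \<subseteq> carrier A" "J \<subseteq> carrier A"
    using I J by (auto simp: two_sided_ideal_def right_ideal_def dest: additive_subgroup.a_subset)
  have "subgroup ?P (add_monoid A)"
    unfolding brace_star_set_def by (rule plus.generate_is_subgroup) (use IJ in auto)
  then interpret P: additive_subgroup ?P A
    by (simp add: additive_subgroup_def)
  have gen: "x \<star> y \<in> ?P" if "x \<in> I" "y \<in> J" for x y
    unfolding brace_star_set_def using that by (blast intro: generate.incl)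
  have "u \<star> a \<in> ?P \<and> a \<star> u \<in> ?P" if "u \<in> ?P" and a: "a \<in> carrier A" for u a
    using that(1) unfolding brace_star_set_def
  proof (fold brace_star_set_def, induction rule: generate.induct)
    case one
    then show ?case
      using a by simp
  next
    case (incl h)
    then obtain x y where xy: "x \<in> I" "y \<in> J" "h = x \<star> y"
      by blast
    then have "h \<star> a = x \<star> (y \<star> a)" "a \<star> h = (a \<star> x) \<star> y"
      using IJ a by (auto simp: star_assoc subset_iff)
    then show ?case
      using gen xy I J a by (simp add: two_sided_ideal_def right_ideal_def)
  next
    case (inv h)
    then obtain x y where xy: "x \<in> I" "y \<in> J" "h = x \<star> y"
      by blast
    then have h: "h \<in> carrier A" and eq: "h \<star> a = x \<star> (y \<star> a)" "a \<star> h = (a \<star> x) \<star> y"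
      using IJ a by (auto simp: star_assoc subset_iff)
    then have "h \<star> a \<in> ?P" "a \<star> h \<in> ?P"
      using gen xy I J a by (simp_all add: two_sided_ideal_def right_ideal_def)
    then show ?case
      using h a by (fold a_inv_def) (simp add: star_minus_left star_minus_right)
  next
    case (eng u v)
    then have uv: "u \<in> ?P" "v \<in> ?P"
      by (simp_all add: brace_star_set_def)
    then have "u \<in> carrier A" "v \<in> carrier A"
      using P.a_subset by auto
    then show ?case
      using eng uv a by (simp add: star_distrib_left star_distrib_right)
  qed
  then show ?thesis
    using P.additive_subgroup_axioms by (simp add: two_sided_ideal_def right_ideal_def)
qed

lemma two_sided_ideal_derived: "two_sided_ideal (brace_derived A n)"
proof (induction n)
  case 0
  then show ?case
    using plus.subgroup_self
    by (simp add: two_sided_ideal_def right_ideal_def additive_subgroup_def)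
qed (simp add: two_sided_ideal_star_set)

text \<open>Links ring ideals to the ideals that define \<open>brace_genideal\<close>: circle
  products, inverses, conjugates and \<open>brace_lambda\<close> are all expressed through
  \<open>\<oplus>\<close> and \<open>\<star>\<close>.\<close>

lemma brace_ideal_of_two_sided_ideal:
  assumes I: "two_sided_ideal I"
  shows "brace_ideal I A"
proof -
  interpret I: additive_subgroup I A
    using I by (simp add: two_sided_ideal_def right_ideal_def)
  have l: "a \<star> x \<in> I" and r: "x \<star> a \<in> I" if "x \<in> I" "a \<in> carrier A" for x a
    using I that by (simp_all add: two_sided_ideal_def right_ideal_def)
  have "subgroup I A"
  proof (rule circ.subgroupI)
    show "I \<subseteq> carrier A"
      by (rule I.a_subset)
    show "I \<noteq> {}"
      using I.zero_closed by blast
    fix x assume x: "x \<in> I"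
    then have "x \<oplus> inv x \<oplus> x \<star> inv x = \<zero>"
      using circ_eq[of x "inv x"] by (simp add: one_eq_zero)
    \<comment> \<open>Here \<open>inv x\<close> occurs on the right only as a factor next to
      \<open>x\<close>, so right absorption suffices.\<close>
    then have "inv x = \<ominus> (x \<oplus> x \<star> inv x)"
      using x by (intro minus_equality[symmetric]) (simp_all add: a_ac)
    then show "inv x \<in> I"
      using x r[of x "inv x"] by (metis I.a_Hcarr I.a_closed I.a_inv_closed circ.inv_closed)
    fix y assume "y \<in> I"
    then show "x \<otimes> y \<in> I"
      using x r[of x y] by (simp add: circ_eq)
  qed
  moreover have "g \<otimes> x \<otimes> inv g \<in> I" if x: "x \<in> I" and g: "g \<in> carrier A" for g x
  proof -
    \<comment> \<open>Chosen so that \<open>g \<otimes> x = g \<oplus> p\<close>;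
      \<open>right_compat\<close> then splits off \<open>g \<otimes> inv g\<close>, which is zero,
      and the two copies of \<open>inv g\<close> cancel.\<close>
    define p where "p = x \<oplus> g \<star> x"
    have p: "p \<in> I"
      using x g l by (simp add: p_def)
    have "g \<otimes> x = g \<oplus> p"
      using x g by (simp add: circ_eq p_def a_assoc)
    then have "g \<otimes> x \<otimes> inv g = (g \<otimes> inv g) \<ominus> inv g \<oplus> (p \<oplus> inv g \<oplus> p \<star> inv g)"
      using g p by (simp add: right_compat circ_eq[of p "inv g"])
    also have "\<dots> = p \<oplus> p \<star> inv g"
      using g p by (simp add: one_eq_zero minus_eq a_ac r_neg1 r_neg2)
    finally show ?thesis
      using p r g by simp
  qed
  moreover have "brace_lambda A a ` I \<subseteq> I" if "a \<in> carrier A" for a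
    using that l by (auto simp: lambda_eq)
  moreover have "a <+ I = I +> a" if "a \<in> carrier A" for a
    using that by (force simp: a_l_coset_def' a_r_coset_def' intro: a_comm)
  ultimately show ?thesis
    by (simp add: brace_ideal_def circ.normal_inv_iff)
qed

section \<open>Strict descent in the finite case\<close>

text \<open>With \<open>D\<close> the current term, \<open>D \<star> D\<close> lies in
  \<open>D \<star> A\<close>, which lies in \<open>D\<close> and differs from it by
  \<open>nakayama\<close>.\<close>

lemma derived_psubset:
  assumes "finite (carrier A)" "brace_derived A n \<noteq> {\<zero>}"
  shows "brace_derived A (Suc n) \<subset> brace_derived A n"
proof -
  let ?D = "brace_derived A n"
  have D: "right_ideal ?D"
    using two_sided_ideal_derived by (simp add: two_sided_ideal_def)
  then interpret D: additive_subgroup ?D A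
    by (simp add: right_ideal_def)
  have "brace_derived A (Suc n) \<subseteq> brace_star_set A ?D (carrier A)"
    unfolding brace_derived.simps brace_star_set_def
    by (rule mono_generate) (use D.a_subset in auto)
  moreover have "brace_star_set A ?D (carrier A) \<subseteq> ?D"
    using D by (intro star_set_subset) (auto simp: right_ideal_def)
  moreover have "\<not> ?D \<subseteq> brace_star_set A ?D (carrier A)"
    using nakayama D assms finite_subset[OF D.a_subset] by blast
  ultimately show ?thesis
    by blast
qed

lemma finite_imp_brace_solvable:
  assumes fin: "finite (carrier A)"
  shows "brace_solvable A"
proof (rule ccontr)
  assume "\<not> brace_solvable A"
  then have dec: "brace_derived A (Suc n) \<subset> brace_derived A n" for n
    using derived_psubset[OF fin] by (auto simp: brace_solvable_def)
  \<comment> \<open>Each step loses at least one element. Finiteness is carried along because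
    comparing cardinalities requires it.\<close>
  have "finite (brace_derived A n) \<and> card (brace_derived A n) + n \<le> card (carrier A)" for n
  proof (induction n)
    case 0
    then show ?case
      using fin by simp
  next
    case (Suc n)
    then have "card (brace_derived A (Suc n)) < card (brace_derived A n)"
      using psubset_card_mono[OF _ dec[of n]] by blast
    moreover have "finite (brace_derived A (Suc n))"
      using Suc dec[of n] finite_subset by blast
    ultimately show ?case
      using Suc by linarith
  qed
  \<comment> \<open>One step more than there are elements already breaks the bound.\<close>
  from this[of "Suc (card (carrier A))"] show False
    by simp
qed

section \<open>Sequences inside the derived series\<close>

text \<open>The derived term is itself a brace ideal containing \<open>a i\<close>, hence contains
  the ideal generated by \<open>a i\<close>; monotonicity of generation passes to the next index.
  Both indexings start at 0, so no shift occurs.\<close>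

lemma n_sequence_mem_derived:
  assumes "n_sequence A a"
  shows "a i \<in> brace_derived A i"
proof (induction i)
  case 0
  then show ?case
    using assms by (simp add: n_sequence_def)
next
  case (Suc i)
  let ?I = "brace_genideal A (a i)"
  have "?I \<subseteq> brace_derived A i"
    unfolding brace_genideal_def
    using Suc brace_ideal_of_two_sided_ideal[OF two_sided_ideal_derived] by blast
  then have "brace_star_set A ?I ?I \<subseteq> brace_derived A (Suc i)"
    unfolding brace_derived.simps brace_star_set_def by (intro mono_generate) blast
  then show ?case
    using assms by (auto simp: n_sequence_def)
qed

lemma brace_solvable_imp_baer_radical: "brace_solvable A \<Longrightarrow> baer_radical A"
  using n_sequence_mem_derived by (fastforce simp: brace_solvable_def baer_radical_def)

end

theorem theorem5p6:
  fixes A :: "('a, 'm) ring_scheme"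
  assumes "two_sided_brace A"
    and "finite (carrier A)"
  shows "baer_radical A \<longleftrightarrow> brace_solvable A"
  using assms two_sided_brace.finite_imp_brace_solvable
    two_sided_brace.brace_solvable_imp_baer_radical by blast

end
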